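(* Let $DSR$ be the set of $3\times 3$ fractal tiling configurations whose zero distribution in $M_0$ is symmetric with respect to exactly one of the two diagonals of $M_0$, taken without redundancy (i.e. configurations generating the same matrices $M_k$ for all $k\ge 0$ are identified, so that each class of identical configurations is counted as one element). Then the number of different configurations for the group action of $G$ on $DSR$, i.e. the number $|DSR/G|$ of $G$-orbits in $DSR$, is $11043660$.
   Context: The group $G$. $G$ is the planar symmetry group of order 8 acting on square matrices (of any size) viewed as plane patterns. Its elements are: $R_0=\mathrm{Id},R_1,R_2,R_3$, the counterclockwise rotations by $0^\circ,90^\circ,180^\circ,270^\circ$; and $K_i=M\circ R_i$ ($i=0,1,2,3$), where $M$ is the horizontal mirror transformation (reflection across the horizontal axis, reversing the order of the rows). Thus $K_1$ is the ordinary transpose (reflection in the principal diagonal, from upper left to lower right) and $K_3$ is the reflection in the second diagonal. Configurations and generated matrices. An $n\times n$ configuration $c$ assigns to each position $(i,j)$, $1\le i,j\le n$, either the symbol $0$ or a transformation $c_{ij}\in G$. Its initial tile is the binary matrix $M_0$ with $M_0(i,j)=0$ if $c_{ij}=0$ and $M_0(i,j)=1$ otherwise. For $k\ge 0$, the matrix $M_{k+1}$, of size $n^{k+2}\times n^{k+2}$, is the $n\times n$ block matrix whose $(i,j)$ block is the zero matrix of the size of $M_k$ if $c_{ij}=0$, and is $c_{ij}(M_k)$ if $c_{ij}\in G$. Two configurations are identical if they generate the same matrix $M_k$ for every $k\ge 0$. The sets $DS$ and $DSR$. Here $n=3$. $DS$ is the set of all $3\times3$ configurations such that the set of zero positions of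 $M_0$ is symmetric with respect to one of the two diagonals of $M_0$ and is not symmetric with respect to the other diagonal. $DSR$ is the set of classes of elements of $DS$ modulo being identical (equivalently, one representative is kept from each class). The action of $G$. For $T\in G$ let $\pi_T$ be the permutation of positions induced by $T$ (the entry of a matrix $A$ at position $p$ appears in $T(A)$ at position $\pi_T(p)$). $T$ sends a configuration $c$ to the configuration $T\cdot c$ with $(T\cdot c)_{\pi_T(p)}=T c_p T^{-1}$ if $c_p\in G$ and $(T\cdot c)_{\pi_T(p)}=0$ if $c_p=0$. Equivalently, if $c$ generates $(M_k)_{k\ge0}$, then $T\cdot c$ generates $(T(M_k))_{k\ge 0}$. This induces an action of $G$ on $DSR$: two configurations are in the same orbit when the pattern of one is obtained from that of the other by a rotation and/or mirror reflection. *)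

theory Defs
  imports "Jordan_Normal_Form.Matrix" "HOL-Algebra.Group_Action"
begin

text \<open>
  Matrices are those of \<^theory>\<open>Jordan_Normal_Form.Matrix\<close>: rows are numbered from top to
  bottom and columns from left to right, starting with 0.
\<close>

datatype sym = R0 | R1 | R2 | R3 | K0 | K1 | K2 | K3

text \<open>Counterclockwise rotation by 90 degrees: the last column becomes the first row.\<close>

definition rot :: "'a mat \<Rightarrow> 'a mat" where
  "rot A = mat (dim_col A) (dim_row A) (\<lambda>(i, j). A $$ (j, dim_col A - 1 - i))"

definition mirror :: "'a mat \<Rightarrow> 'a mat" where
  "mirror A = mat (dim_row A) (dim_col A) (\<lambda>(i, j). A $$ (dim_row A - 1 - i, j))"

primrec transform :: "sym \<Rightarrow> 'a mat \<Rightarrow> 'a mat" where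
  "transform R0 = id"
| "transform R1 = rot"
| "transform R2 = rot \<circ> rot"
| "transform R3 = rot \<circ> rot \<circ> rot"
| "transform K0 = mirror"
| "transform K1 = mirror \<circ> rot"
| "transform K2 = mirror \<circ> (rot \<circ> rot)"
| "transform K3 = mirror \<circ> (rot \<circ> rot \<circ> rot)"

text \<open>
  The product is composition of transformations; existence and uniqueness of the element
  described here are \<open>transform_sym_mult\<close> and \<open>transform_inject\<close> below.
\<close>

definition sym_mult :: "sym \<Rightarrow> sym \<Rightarrow> sym" where
  "sym_mult S T = (THE U. (transform U :: nat mat \<Rightarrow> nat mat) = transform S \<circ> transform T)"

definition G :: "sym monoid" where
  "G = \<lparr>carrier = UNIV, mult = sym_mult, one = R0\<rparr>"

lemma rot4: "rot (rot (rot (rot A))) = A"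
  by (rule eq_matI) (auto simp: rot_def)

lemma mirror2: "mirror (mirror A) = A"
  by (rule eq_matI) (auto simp: mirror_def)

lemma rot_mirror: "rot (mirror A) = mirror (rot (rot (rot A)))"
  by (rule eq_matI) (auto simp: rot_def mirror_def)

lemma transform_K1: "transform K1 A = transpose_mat A"
  by (rule eq_matI) (auto simp: rot_def mirror_def)

lemma transform_K3:
  assumes "A \<in> carrier_mat n n"
  shows "transform K3 A = mat n n (\<lambda>(i, j). A $$ (n - 1 - j, n - 1 - i))"
  using assms by (intro eq_matI) (auto simp: rot_def mirror_def)

lemma transform_inject:
  assumes "(transform S :: nat mat \<Rightarrow> nat mat) = transform T"
  shows "S = T"
proof -
  let ?A = "mat 2 2 (\<lambda>(i, j). 2 * i + j) :: nat mat"
  have "\<forall>p. transform S ?A $$ p = transform T ?A $$ p"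
    using assms by simp
  then have "transform S ?A $$ (0, 0) = transform T ?A $$ (0, 0)"
    "transform S ?A $$ (0, 1) = transform T ?A $$ (0, 1)"
    by blast+
  then show ?thesis
    by (cases S; cases T) (simp_all add: rot_def mirror_def)
qed

lemma transform_closed:
  "\<exists>U. (\<forall>A :: nat mat. transform U A = transform S (transform T A)) \<and>
       (\<forall>A :: 'a mat. transform U A = transform S (transform T A))"
proof -
  have ex: "\<exists>U. P U" if "P R0 \<or> P R1 \<or> P R2 \<or> P R3 \<or> P K0 \<or> P K1 \<or> P K2 \<or> P K3" for P
    using that by blast
  show ?thesis
    by (rule ex, cases S; cases T) (simp_all add: rot4 mirror2 rot_mirror)
qed

lemma transform_sym_mult: "transform (sym_mult S T) A = transform S (transform T A)"
proof -
  obtain U where U: "\<And>A :: nat mat. transform U A = transform S (transform T A)"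
    "\<And>A :: 'a mat. transform U A = transform S (transform T A)"
    using transform_closed by blast
  have "sym_mult S T = U"
    unfolding sym_mult_def
  proof (rule the_equality)
    show "(transform U :: nat mat \<Rightarrow> nat mat) = transform S \<circ> transform T"
      using U(1) by auto
  next
    fix V
    assume V: "(transform V :: nat mat \<Rightarrow> nat mat) = transform S \<circ> transform T"
    have "(transform V :: nat mat \<Rightarrow> nat mat) = transform U"
      unfolding V using U(1) by auto
    then show "V = U"
      by (rule transform_inject)
  qed
  then show ?thesis
    using U(2) by simp
qed

lemma group_G: "group G"
proof (rule groupI)
  have eqI: "S = T" if "\<And>A :: nat mat. transform S A = transform T A" for S T
    using that by (intro transform_inject) auto
  show "x \<otimes>\<^bsub>G\<^esub> y \<otimes>\<^bsub>G\<^esub> z = x \<otimes>\<^bsub>G\<^esub> (y \<otimes>\<^bsub>G\<^esub> z)" for x y z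
    by (rule eqI) (simp add: G_def transform_sym_mult)
  show "\<one>\<^bsub>G\<^esub> \<otimes>\<^bsub>G\<^esub> x = x" for x
    by (rule eqI) (simp add: G_def transform_sym_mult)
  show "\<exists>y \<in> carrier G. y \<otimes>\<^bsub>G\<^esub> x = \<one>\<^bsub>G\<^esub>" for x
  proof -
    have "sym_mult R0 R0 = R0" "sym_mult R3 R1 = R0" "sym_mult R2 R2 = R0" "sym_mult R1 R3 = R0"
      "sym_mult K0 K0 = R0" "sym_mult K1 K1 = R0" "sym_mult K2 K2 = R0" "sym_mult K3 K3 = R0"
      by (rule eqI, simp add: transform_sym_mult rot4 mirror2 rot_mirror)+
    then show ?thesis
      by (cases x) (auto simp: G_def)
  qed
qed (auto simp: G_def)

text \<open>\<^const>\<open>None\<close> stands for the symbol 0.\<close>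

type_synonym config = "sym option mat"

text \<open>
  \<open>gen c k\<close> is the matrix \<open>M\<^sub>k\<close>; for an \<open>n \<times> n\<close> configuration it has size \<open>n ^ (k + 1)\<close>.
\<close>

primrec gen :: "config \<Rightarrow> nat \<Rightarrow> nat mat" where
  "gen c 0 = map_mat (\<lambda>x. case x of None \<Rightarrow> 0 | Some T \<Rightarrow> 1) c"
| "gen c (Suc k) =
    (let A = gen c k; r = dim_row A; s = dim_col A in
     mat (dim_row c * r) (dim_col c * s)
       (\<lambda>(i, j). case c $$ (i div r, j div s) of
           None \<Rightarrow> 0
         | Some T \<Rightarrow> transform T A $$ (i mod r, j mod s)))"

definition identical :: "config \<Rightarrow> config \<Rightarrow> bool" where
  "identical c d \<longleftrightarrow> (\<forall>k. gen c k = gen d k)"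

definition zero_positions :: "nat mat \<Rightarrow> (nat \<times> nat) set" where
  "zero_positions A = {(i, j). i < dim_row A \<and> j < dim_col A \<and> A $$ (i, j) = 0}"

definition symmetric_principal :: "(nat \<times> nat) set \<Rightarrow> bool" where
  "symmetric_principal Z \<longleftrightarrow> (\<lambda>(i, j). (j, i)) ` Z = Z"

definition symmetric_second :: "nat \<Rightarrow> (nat \<times> nat) set \<Rightarrow> bool" where
  "symmetric_second n Z \<longleftrightarrow> (\<lambda>(i, j). (n - 1 - j, n - 1 - i)) ` Z = Z"

definition DS :: "config set" where
  "DS = {c \<in> carrier_mat 3 3.
     let Z = zero_positions (gen c 0) in
       symmetric_principal Z \<and> \<not> symmetric_second 3 Z \<or>
       symmetric_second 3 Z \<and> \<not> symmetric_principal Z}"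

definition DSR :: "config set set" where
  "DSR = DS // {(c, d) \<in> DS \<times> DS. identical c d}"

text \<open>
  The entry of \<open>c\<close> at position \<open>p\<close>, conjugated by \<open>T\<close>, has to appear at the position to which
  \<open>T\<close> moves \<open>p\<close>; so the matrix \<open>c\<close> is itself transformed by \<open>T\<close>.
\<close>

definition act :: "sym \<Rightarrow> config \<Rightarrow> config" where
  "act T c = map_mat (map_option (\<lambda>g. T \<otimes>\<^bsub>G\<^esub> g \<otimes>\<^bsub>G\<^esub> inv\<^bsub>G\<^esub> T)) (transform T c)"

definition act_class :: "sym \<Rightarrow> config set \<Rightarrow> config set" where
  "act_class T = (\<lambda>C \<in> DSR. act T ` C)"

text \<open>
  The rest shows that \<open>act T c\<close> generates the images under \<open>T\<close> of the matrices generated by \<open>c\<close>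
  (\<open>gen_act\<close>) and that \<open>act_class\<close> is a group action on \<open>DSR\<close> (\<open>group_action_DSR\<close>).
\<close>

definition blk :: "('b \<Rightarrow> nat mat) \<Rightarrow> 'b mat \<Rightarrow> nat \<Rightarrow> nat mat" where
  "blk F c m = mat (dim_row c * m) (dim_col c * m)
     (\<lambda>(i, j). F (c $$ (i div m, j div m)) $$ (i mod m, j mod m))"

definition tile :: "nat mat \<Rightarrow> sym option \<Rightarrow> nat mat" where
  "tile A x = (case x of None \<Rightarrow> 0\<^sub>m (dim_row A) (dim_row A) | Some T \<Rightarrow> transform T A)"

lemma transform_carrier: "A \<in> carrier_mat n n \<Longrightarrow> transform T A \<in> carrier_mat n n"
  by (cases T) (auto simp: rot_def mirror_def)

lemma gen_carrier: "c \<in> carrier_mat n n \<Longrightarrow> gen c k \<in> carrier_mat (n ^ Suc k) (n ^ Suc k)"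
  by (induction k) (auto simp: Let_def)

lemma divmod_rev:
  fixes i n m :: nat
  assumes "i < n * m"
  shows "(n * m - Suc i) div m = n - Suc (i div m)" "(n * m - Suc i) mod m = m - Suc (i mod m)"
proof -
  have m: "m > 0" using assms by (cases m) auto
  define q r where "q = i div m" and "r = i mod m"
  have i: "i = q * m + r" and r: "r < m" using m by (auto simp: q_def r_def)
  have q: "q < n" using assms by (simp add: q_def less_mult_imp_div_less)
  then obtain d where d: "n = Suc (q + d)" using less_imp_Suc_add by blast
  define t where "t = m - Suc r"
  have t: "t < m" "m - Suc r = t" using r by (auto simp: t_def)
  have e: "n * m - Suc i = d * m + t" 
    using r by (simp add: i d t_def algebra_simps)
  show "(n * m - Suc i) div m = n - Suc (i div m)" "(n * m - Suc i) mod m = m - Suc (i mod m)"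
    unfolding e using t by (auto simp: d q_def[symmetric] r_def[symmetric])
qed

lemma rot_blk:
  assumes c: "c \<in> carrier_mat n n" and F: "\<And>x. F x \<in> carrier_mat m m"
  shows "rot (blk F c m) = blk (\<lambda>x. rot (F x)) (rot c) m"
proof (rule eq_matI)
  have dF[simp]: "dim_row (F x) = m" "dim_col (F x) = m" for x using F[of x] by auto
  fix i j assume "i < dim_row (blk (\<lambda>x. rot (F x)) (rot c) m)" "j < dim_col (blk (\<lambda>x. rot (F x)) (rot c) m)"
  then have ij: "i < n * m" "j < n * m" using c by (auto simp: blk_def rot_def)
  then have m: "m > 0" by (cases m) auto
  show "rot (blk F c m) $$ (i,j) = blk (\<lambda>x. rot (F x)) (rot c) m $$ (i,j)"
    using ij c m by (auto simp: blk_def rot_def divmod_rev less_mult_imp_div_less)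
qed (use c in \<open>auto simp: blk_def rot_def\<close>)

lemma mirror_blk:
  assumes c: "c \<in> carrier_mat n n" and F: "\<And>x. F x \<in> carrier_mat m m"
  shows "mirror (blk F c m) = blk (\<lambda>x. mirror (F x)) (mirror c) m"
proof (rule eq_matI)
  have dF[simp]: "dim_row (F x) = m" "dim_col (F x) = m" for x using F[of x] by auto
  fix i j assume "i < dim_row (blk (\<lambda>x. mirror (F x)) (mirror c) m)" "j < dim_col (blk (\<lambda>x. mirror (F x)) (mirror c) m)"
  then have ij: "i < n * m" "j < n * m" using c by (auto simp: blk_def mirror_def)
  then have m: "m > 0" by (cases m) auto
  show "mirror (blk F c m) $$ (i,j) = blk (\<lambda>x. mirror (F x)) (mirror c) m $$ (i,j)"
    using ij c m by (auto simp: blk_def mirror_def divmod_rev less_mult_imp_div_less)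
qed (use c in \<open>auto simp: blk_def mirror_def\<close>)

lemma rot_carrier: "A \<in> carrier_mat n n \<Longrightarrow> rot A \<in> carrier_mat n n"
  by (auto simp: rot_def)

lemma transform_blk:
  assumes c: "c \<in> carrier_mat n n" and F: "\<And>x. F x \<in> carrier_mat m m"
  shows "transform T (blk F c m) = blk (\<lambda>x. transform T (F x)) (transform T c) m"
  by (cases T) (simp_all add: rot_blk[where n=n] mirror_blk[where n=n] c F rot_carrier)

lemma gen_Suc_blk:
  assumes c: "c \<in> carrier_mat n n"
  shows "gen c (Suc k) = blk (tile (gen c k)) c (n ^ Suc k)"
proof -
  have "gen c k \<in> carrier_mat (n ^ Suc k) (n ^ Suc k)" using gen_carrier[OF c] .
  then have g: "dim_row (gen c k) = n ^ Suc k" "dim_col (gen c k) = n ^ Suc k" by auto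
  show ?thesis
    by (rule eq_matI) (use c in \<open>auto simp: blk_def tile_def g Let_def split: option.splits simp del: power_Suc\<close>,
       (metis less_nat_zero_code mod_less_divisor mult_0_right neq0_conv index_zero_mat(1))+)
qed

lemma blk_map: "c \<in> carrier_mat n n \<Longrightarrow> blk F (map_mat f c) m = blk (\<lambda>x. F (f x)) c m"
  by (rule eq_matI) (auto simp: blk_def less_mult_imp_div_less)

lemma transform_zero: "transform T (0\<^sub>m n n :: nat mat) = 0\<^sub>m n n"
  by (cases T; rule eq_matI) (auto simp: rot_def mirror_def)

lemma transform_map: "transform T (map_mat f c) = map_mat f (transform T c)" if "c \<in> carrier_mat n n"
  using that by (cases T; intro eq_matI) (auto simp: rot_def mirror_def)

lemma act_carrier: "c \<in> carrier_mat n n \<Longrightarrow> act T c \<in> carrier_mat n n"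
  using transform_carrier[of c n T] by (simp add: act_def)

lemma transform_conj: "transform (T \<otimes>\<^bsub>G\<^esub> g \<otimes>\<^bsub>G\<^esub> inv\<^bsub>G\<^esub> T) (transform T A) = transform T (transform g A)"
proof -
  interpret group G by (rule group_G)
  have "transform (T \<otimes>\<^bsub>G\<^esub> g \<otimes>\<^bsub>G\<^esub> inv\<^bsub>G\<^esub> T) (transform T A) = transform (T \<otimes>\<^bsub>G\<^esub> g \<otimes>\<^bsub>G\<^esub> inv\<^bsub>G\<^esub> T \<otimes>\<^bsub>G\<^esub> T) A"
    by (simp add: G_def transform_sym_mult)
  also have "T \<otimes>\<^bsub>G\<^esub> g \<otimes>\<^bsub>G\<^esub> inv\<^bsub>G\<^esub> T \<otimes>\<^bsub>G\<^esub> T = T \<otimes>\<^bsub>G\<^esub> g"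
    by (subst m_assoc) (auto simp: G_def[THEN arg_cong[where f=carrier]] l_inv)
  finally show ?thesis by (simp add: G_def transform_sym_mult)
qed

lemma gen_act:
  assumes c: "c \<in> carrier_mat n n"
  shows "gen (act T c) k = transform T (gen c k)"
proof (induction k)
  case 0
  show ?case by (simp add: act_def transform_map[OF c]) (rule eq_matI; auto split: option.split)
next
  case (Suc k)
  have g: "gen c k \<in> carrier_mat (n ^ Suc k) (n ^ Suc k)" using gen_carrier[OF c] .
  have t: "tile (gen c k) x \<in> carrier_mat (n ^ Suc k) (n ^ Suc k)" for x
    using g transform_carrier[OF g] by (auto simp: tile_def split: option.split)
  have g': "dim_row (gen c k) = n ^ Suc k" "dim_row (transform T (gen c k)) = n ^ Suc k"
    using g transform_carrier[OF g] by auto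
  have "gen (act T c) (Suc k) = blk (tile (transform T (gen c k))) (act T c) (n ^ Suc k)"
    unfolding gen_Suc_blk[OF act_carrier[OF c]] Suc ..
  also have "\<dots> = blk (\<lambda>x. tile (transform T (gen c k)) (map_option (\<lambda>g. T \<otimes>\<^bsub>G\<^esub> g \<otimes>\<^bsub>G\<^esub> inv\<^bsub>G\<^esub> T) x)) (transform T c) (n ^ Suc k)"
    unfolding act_def by (rule blk_map[OF transform_carrier[OF c]])
  also have "(\<lambda>x. tile (transform T (gen c k)) (map_option (\<lambda>g. T \<otimes>\<^bsub>G\<^esub> g \<otimes>\<^bsub>G\<^esub> inv\<^bsub>G\<^esub> T) x)) = (\<lambda>x. transform T (tile (gen c k) x))"
    by (auto simp: tile_def transform_conj g' transform_zero simp del: power_Suc split: option.split)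
  also have "blk \<dots> (transform T c) (n ^ Suc k) = transform T (gen c (Suc k))"
    unfolding gen_Suc_blk[OF c] transform_blk[OF c t] ..
  finally show ?case .
qed


lemma zero_positions_principal:
  assumes M: "M \<in> carrier_mat n n" and b: "\<And>i j. i < n \<Longrightarrow> j < n \<Longrightarrow> M $$ (i, j) = 0 \<or> M $$ (i, j) = 1"
  shows "symmetric_principal (zero_positions M) \<longleftrightarrow> transform K1 M = M"
proof
  assume "symmetric_principal (zero_positions M)"
  then have "(j, i) \<in> zero_positions M" if "(i, j) \<in> zero_positions M" for i j
    using that unfolding symmetric_principal_def by force
  then have "M $$ (j, i) = 0 \<longleftrightarrow> M $$ (i, j) = 0" if "i < n" "j < n" for i j
    using that M by (auto simp: zero_positions_def)
  then have "M $$ (j, i) = M $$ (i, j)" if "i < n" "j < n" for i j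
    using that b by metis
  then show "transform K1 M = M"
    unfolding transform_K1 using M by (intro eq_matI) auto
next
  assume "transform K1 M = M"
  then have "M $$ (j, i) = M $$ (i, j)" if "i < n" "j < n" for i j
    using that M unfolding transform_K1 by (metis carrier_matD index_transpose_mat(1))
  then have "(j, i) \<in> zero_positions M" if "(i, j) \<in> zero_positions M" for i j
    using that M by (auto simp: zero_positions_def)
  then show "symmetric_principal (zero_positions M)"
    unfolding symmetric_principal_def by force
qed

lemma zero_positions_second:
  assumes M: "M \<in> carrier_mat n n" and b: "\<And>i j. i < n \<Longrightarrow> j < n \<Longrightarrow> M $$ (i, j) = 0 \<or> M $$ (i, j) = 1"
  shows "symmetric_second n (zero_positions M) \<longleftrightarrow> transform K3 M = M"
proof
  assume s: "symmetric_second n (zero_positions M)"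
  have "(n - 1 - j, n - 1 - i) \<in> zero_positions M" if "(i, j) \<in> zero_positions M" for i j
  proof -
    have "(\<lambda>(i, j). (n - 1 - j, n - 1 - i)) (i, j) \<in> (\<lambda>(i, j). (n - 1 - j, n - 1 - i)) ` zero_positions M"
      using that by (rule imageI)
    then show ?thesis using s by (simp add: symmetric_second_def)
  qed
  then have imp: "M $$ (i, j) = 0 \<Longrightarrow> M $$ (n - 1 - j, n - 1 - i) = 0" if "i < n" "j < n" for i j
    using that M by (auto simp: zero_positions_def)
  have "M $$ (n - 1 - j, n - 1 - i) = 0 \<longleftrightarrow> M $$ (i, j) = 0" if "i < n" "j < n" for i j
    using imp[OF that] imp[of "n - 1 - j" "n - 1 - i"] that by auto
  then have "M $$ (n - 1 - j, n - 1 - i) = M $$ (i, j)" if "i < n" "j < n" for i j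
    using b[OF that] b[of "n - 1 - j" "n - 1 - i"] that
    by (metis diff_Suc_less diff_diff_eq less_nat_zero_code not_gr_zero plus_1_eq_Suc)
  then show "transform K3 M = M"
    unfolding transform_K3[OF M] using M by (intro eq_matI) auto
next
  assume t: "transform K3 M = M"
  have "M $$ (n - 1 - j, n - 1 - i) = M $$ (i, j)" if "i < n" "j < n" for i j
    using arg_cong[OF t, of "\<lambda>A. A $$ (i, j)"] that unfolding transform_K3[OF M] by auto
  then have z: "(n - 1 - j, n - 1 - i) \<in> zero_positions M" if "(i, j) \<in> zero_positions M" for i j
    using that M by (auto simp: zero_positions_def)
  show "symmetric_second n (zero_positions M)"
    unfolding symmetric_second_def
  proof (intro subset_antisym subsetI)
    fix p assume "p \<in> zero_positions M"
    moreover obtain i j where "p = (i, j)" by force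
    moreover have "i < n" "j < n" using calculation M by (auto simp: zero_positions_def)
    ultimately show "p \<in> (\<lambda>(i, j). (n - 1 - j, n - 1 - i)) ` zero_positions M"
      using z by (intro image_eqI[where x = "(n - 1 - j, n - 1 - i)"]) auto
  qed (use z in auto)
qed

lemma DS_iff:
  "c \<in> DS \<longleftrightarrow> c \<in> carrier_mat 3 3 \<and> (transform K1 (gen c 0) = gen c 0) \<noteq> (transform K3 (gen c 0) = gen c 0)"
proof (cases "c \<in> carrier_mat 3 3")
  case True
  then have M: "gen c 0 \<in> carrier_mat 3 3" by simp
  have b: "gen c 0 $$ (i, j) = 0 \<or> gen c 0 $$ (i, j) = 1" if "i < 3" "j < 3" for i j
    using that True by (auto split: option.split)
  show ?thesis
    unfolding DS_def Let_def using True zero_positions_principal[OF M b] zero_positions_second[OF M b]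
    by blast
qed (simp add: DS_def)

lemma transform_eq_iff: "transform T A = transform T B \<longleftrightarrow> A = B"
proof
  assume "transform T A = transform T B"
  then have "transform (inv\<^bsub>G\<^esub> T \<otimes>\<^bsub>G\<^esub> T) A = transform (inv\<^bsub>G\<^esub> T \<otimes>\<^bsub>G\<^esub> T) B"
    by (simp add: G_def transform_sym_mult)
  moreover have "inv\<^bsub>G\<^esub> T \<otimes>\<^bsub>G\<^esub> T = R0"
    using group.l_inv[OF group_G, of T] by (simp add: G_def)
  ultimately show "A = B" by simp
qed simp

lemma act_DS: "act T c \<in> DS" if "c \<in> DS"
proof -
  have c: "c \<in> carrier_mat 3 3" using that by (simp add: DS_iff)
  have K: "\<exists>P \<in> {(K1, K3), (K3, K1)}. \<forall>A :: nat mat.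
     transform K1 (transform T A) = transform T (transform (fst P) A) \<and>
     transform K3 (transform T A) = transform T (transform (snd P) A)"
    by (cases T) (simp_all add: rot4 mirror2 rot_mirror)
  then show ?thesis
    using that act_carrier[OF c, of T] unfolding DS_iff gen_act[OF c]
    by (auto simp: transform_eq_iff simp del: transform.simps gen.simps)
qed

lemma act_mult:
  assumes c: "c \<in> carrier_mat n n"
  shows "act (S \<otimes>\<^bsub>G\<^esub> T) c = act S (act T c)"
proof -
  interpret group G by (rule group_G)
  have [simp]: "x \<in> carrier G" for x by (simp add: G_def)
  have t: "transform (S \<otimes>\<^bsub>G\<^esub> T) c = transform S (transform T c)" by (simp add: G_def transform_sym_mult)
  have "act S (act T c) = map_mat (map_option (\<lambda>g. S \<otimes>\<^bsub>G\<^esub> g \<otimes>\<^bsub>G\<^esub> inv\<^bsub>G\<^esub> S))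
      (map_mat (map_option (\<lambda>g. T \<otimes>\<^bsub>G\<^esub> g \<otimes>\<^bsub>G\<^esub> inv\<^bsub>G\<^esub> T)) (transform S (transform T c)))"
    unfolding act_def using transform_map[OF transform_carrier[OF c]] by metis
  also have "\<dots> = act (S \<otimes>\<^bsub>G\<^esub> T) c"
    unfolding act_def t
    by (rule eq_matI) (auto simp: option.map_comp o_def m_assoc inv_mult_group)
  finally show ?thesis by simp
qed

lemma act_one: "act \<one>\<^bsub>G\<^esub> c = c"
proof -
  interpret group G by (rule group_G)
  have [simp]: "x \<in> carrier G" for x by (simp add: G_def)
  have "transform \<one>\<^bsub>G\<^esub> c = c" by (simp add: G_def)
  then show ?thesis unfolding act_def by (intro eq_matI) (auto simp: option.map_id[unfolded id_def])
qed

lemma identical_act: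
  "c \<in> carrier_mat n n \<Longrightarrow> d \<in> carrier_mat n n \<Longrightarrow> identical (act T c) (act T d) \<longleftrightarrow> identical c d"
  by (simp add: identical_def gen_act transform_eq_iff)

definition ident_class :: "config \<Rightarrow> config set" where
  "ident_class c = {d \<in> DS. identical c d}"

lemma DSR_ident_class: "DSR = ident_class ` DS"
  unfolding DSR_def quotient_def ident_class_def by auto

lemma act_ident_class:
  assumes c: "c \<in> DS"
  shows "act T ` ident_class c = ident_class (act T c)"
proof (intro subset_antisym subsetI)
  have ca: "x \<in> carrier_mat 3 3" if "x \<in> DS" for x using that by (simp add: DS_iff)
  { fix x assume "x \<in> act T ` ident_class c"
    then show "x \<in> ident_class (act T c)" using c ca act_DS by (auto simp: ident_class_def identical_act[where n=3]) }
  fix x assume x: "x \<in> ident_class (act T c)"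
  interpret group G by (rule group_G)
  have [simp]: "x \<in> carrier G" for x by (simp add: G_def)
  have xD: "x \<in> DS" using x by (simp add: ident_class_def)
  let ?y = "act (inv\<^bsub>G\<^esub> T) x"
  have y: "?y \<in> DS" by (rule act_DS[OF xD])
  have xy: "x = act T ?y" using act_mult[OF ca[OF xD], of T "inv\<^bsub>G\<^esub> T"] act_one by simp
  have "identical (act T c) (act T ?y)" using x xy by (simp add: ident_class_def)
  then have "?y \<in> ident_class c" using y c ca by (simp add: ident_class_def identical_act[where n=3])
  then show "x \<in> act T ` ident_class c" using xy by blast
qed

theorem group_action_DSR: "group_action G DSR act_class"
proof -
  interpret group G by (rule group_G)
  have [simp]: "x \<in> carrier G" for x by (simp add: G_def)
  have ca: "x \<in> carrier_mat 3 3" if "x \<in> DS" for x using that by (simp add: DS_iff)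
  have app: "act_class T (ident_class c) = ident_class (act T c)" if "c \<in> DS" for T c
    using that by (simp add: act_class_def DSR_ident_class act_ident_class)
  have closed: "act_class T C \<in> DSR" if "C \<in> DSR" for T C
    using that app act_DS by (auto simp: DSR_ident_class)
  have mult: "act_class (S \<otimes>\<^bsub>G\<^esub> T) C = act_class S (act_class T C)" if "C \<in> DSR" for S T C
    using that app act_DS act_mult[OF ca] by (auto simp: DSR_ident_class)
  have one: "act_class \<one>\<^bsub>G\<^esub> C = C" if "C \<in> DSR" for C
    using that app act_one by (auto simp: DSR_ident_class)
  have bij: "act_class T \<in> Bij DSR" for T
    unfolding Bij_def
  proof (intro IntI CollectI)
    show "act_class T \<in> extensional DSR" by (simp add: act_class_def)
    show "bij_betw (act_class T) DSR DSR"
      by (rule bij_betwI[where g = "act_class (inv\<^bsub>G\<^esub> T)"])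
         (auto simp: closed one mult[symmetric])
  qed
  show ?thesis
    unfolding group_action_def
  proof (intro group_hom.intro group_hom_axioms.intro homI)
    show "act_class (S \<otimes>\<^bsub>G\<^esub> T) = act_class S \<otimes>\<^bsub>BijGroup DSR\<^esub> act_class T" for S T
      using mult[of _ S T] bij by (auto simp: BijGroup_def compose_def fun_eq_iff act_class_def)
    show "group (BijGroup DSR)" by (rule group_BijGroup)
  qed (auto simp: group_G bij BijGroup_def)
qed

end

theory Submission
  imports Defs
begin

text \<open>
  By Burnside's lemma it suffices to count the classes fixed by each element of the group. Rotation
  by 90 degrees exchanges the two diagonals, so let the zero set be symmetric with respect to the
  principal diagonal only. Then the stabilizer of the initial tile is \<open>{R0, K1}\<close>. If two distinct
  configurations are identical, then at some position their entries are \<open>x\<close> and \<open>x K1\<close>, so \<open>K1\<close>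
  fixes every \<open>M\<^sub>k\<close>. This happens as soon as \<open>K1\<close> fixes \<open>M\<^sub>1\<close>, which is a condition on the cosets
  \<open>x {R0, K1}\<close> of the entries; in that case exactly these cosets can be recovered from the pattern.
  Hence the classes are represented by the configurations whose \<open>M\<^sub>1\<close> is not fixed by \<open>K1\<close>,
  together with those fixed ones all of whose entries are rotations, and only the latter are
  fixed by \<open>K1\<close>.
\<close>

section \<open>Cosets of the reflection in the principal diagonal\<close>

text \<open>The rotation representing the left coset of \<open>{R0, K1}\<close>.\<close>

primrec rotation_part :: "sym \<Rightarrow> sym" where
  "rotation_part R0 = R0"
| "rotation_part R1 = R1"
| "rotation_part R2 = R2"
| "rotation_part R3 = R3"
| "rotation_part K0 = R1"
| "rotation_part K1 = R0"
| "rotation_part K2 = R3"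
| "rotation_part K3 = R2"

text \<open>Conjugation by \<open>K1\<close> inverts rotations.\<close>

primrec reverse :: "sym \<Rightarrow> sym" where
  "reverse R0 = R0"
| "reverse R1 = R3"
| "reverse R2 = R2"
| "reverse R3 = R1"
| "reverse K0 = K0"
| "reverse K1 = K1"
| "reverse K2 = K2"
| "reverse K3 = K3"

lemma UNIV_sym: "(UNIV :: sym set) = {R0, R1, R2, R3, K0, K1, K2, K3}"
  using sym.exhaust by auto

lemma rotation_part_idem: "rotation_part (rotation_part x) = rotation_part x"
  by (cases x) auto

text \<open>Oriented against \<open>rot_mirror\<close>: mirrors move inwards onto the matrix, where
  an equation such as \<open>mirror A = rot A\<close> removes them.\<close>

lemma mirror_rot: "mirror (rot A) = rot (rot (rot (mirror A)))"
  by (simp add: rot_mirror rot4)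

text \<open>Either \<open>x\<close> is its own \<open>rotation_part\<close>, or it is that rotation
  preceded by \<open>K1\<close>, which leaves \<open>A\<close> unchanged.\<close>

lemma transform_rotation_part:
  assumes "transform K1 A = A"
  shows "transform (rotation_part x) A = transform x A"
proof -
  \<comment> \<open>Apply \<open>mirror\<close> to both sides of
    \<open>mirror (rot A) = A\<close>.\<close>
  have "mirror A = rot A"
    using assms by (metis mirror2 o_apply transform.simps(6))
  then show ?thesis
    by (cases x) (simp_all add: mirror_rot rot4)
qed

text \<open>With r the rotation in the coset of \<open>x\<close>,
  \<open>K1 r A = (K1 r K1) A\<close>, and conjugation by \<open>K1\<close> inverts r.\<close>

lemma transform_reverse:
  assumes "transform K1 A = A"
  shows "transform K1 (transform x A) = transform (reverse (rotation_part x)) A"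
proof -
  have "mirror A = rot A"
    using assms by (metis mirror2 o_apply transform.simps(6))
  then show ?thesis
    by (cases x) (simp_all add: mirror_rot rot4)
qed

text \<open>Two distinct elements of one coset satisfy \<open>y = x K1\<close>; then
  \<open>x\<close> is cancelled from \<open>x A = x K1 A\<close>.\<close>

lemma transform_eq_imp_fixed:
  assumes "transform x A = transform y A" "rotation_part x = rotation_part y" "x \<noteq> y"
  shows "transform K1 A = A"
proof -
  have "transform y A = transform x (transform K1 A)"
    using assms(2,3) by (cases x; cases y) (simp_all add: mirror_rot rot4 mirror2)
  with assms(1) show ?thesis
    by (simp add: transform_eq_iff)
qed

text \<open>\<open>K3\<close> is the product of \<open>K1\<close> and the half turn
  \<open>R2\<close>.\<close>

lemma transform_half_turn_imp_fixed_K3: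
  assumes "transform K1 A = A" "transform R2 A = A"
  shows "transform K3 A = A"
  using assms by simp

text \<open>The stabilizer of \<open>A\<close> is exactly \<open>{R0, K1}\<close>: the half turn is
  excluded through \<open>K3\<close>, and a quarter turn fixing \<open>A\<close> would make its
  square, the half turn, fix it too.\<close>

lemma transform_inj_rotation_part:
  assumes K1: "transform K1 A = A" and K3: "transform K3 A \<noteq> A"
    and eq: "transform x A = transform y A"
  shows "rotation_part x = rotation_part y"
proof -
  have "transform (rotation_part x) A = transform (rotation_part y) A"
    using eq transform_rotation_part[OF K1] by metis
  moreover have rr: "rot (rot A) \<noteq> A"
    using transform_half_turn_imp_fixed_K3[OF K1] K3 by auto
  moreover have "rot A \<noteq> A" "rot (rot (rot A)) \<noteq> A"
    using rr rot4 by metis+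
  moreover have "rot X = rot Y \<longleftrightarrow> X = Y" for X Y :: "'a mat"
    using transform_eq_iff[of R1 X Y] by simp
  moreover have "A \<noteq> rot A" "A \<noteq> rot (rot A)" "A \<noteq> rot (rot (rot A))"
    using calculation by metis+
  ultimately show ?thesis
    by - (cases x; cases y; simp)
qed

section \<open>Generated matrices\<close>

lemma tile_carrier: "A \<in> carrier_mat m m \<Longrightarrow> tile A x \<in> carrier_mat m m"
  using transform_carrier by (auto simp: tile_def split: option.split)

text \<open>Entry \<open>(k, l)\<close> of block \<open>(i, j)\<close> sits at
  \<open>(i * m + k, j * m + l)\<close>. The tile functions \<open>F\<close> and \<open>H\<close>
  may differ, so that a block matrix can be compared with its own image under \<open>K1\<close>,
  whose tiles are transformed as well.\<close>

lemma blk_eq_iff: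
  assumes c: "c \<in> carrier_mat n n" and d: "d \<in> carrier_mat n n"
    and F: "\<And>x. F x \<in> carrier_mat m m" and H: "\<And>x. H x \<in> carrier_mat m m"
  shows "blk F c m = blk H d m \<longleftrightarrow> (\<forall>i<n. \<forall>j<n. F (c $$ (i, j)) = H (d $$ (i, j)))"
proof
  assume eq: "blk F c m = blk H d m"
  show "\<forall>i<n. \<forall>j<n. F (c $$ (i, j)) = H (d $$ (i, j))"
  proof (intro allI impI eq_matI)
    fix i j k l
    assume ij: "i < n" "j < n" and "k < dim_row (H (d $$ (i, j)))" "l < dim_col (H (d $$ (i, j)))"
    then have kl: "k < m" "l < m"
      using H[of "d $$ (i, j)"] by auto
    have lt: "a * m + b < n * m" if "a < n" "b < m" for a b
    proof -
      have "a * m + b < Suc a * m" using that by simp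
      also have "\<dots> \<le> n * m" using that by (intro mult_le_mono1) simp
      finally show ?thesis .
    qed
    have "blk F c m $$ (i * m + k, j * m + l) = blk H d m $$ (i * m + k, j * m + l)"
      by (simp add: eq)
    then show "F (c $$ (i, j)) $$ (k, l) = H (d $$ (i, j)) $$ (k, l)"
      using lt[of i k] lt[of j l] ij kl c d by (simp add: blk_def)
  qed (use F H in \<open>metis carrier_matD\<close>)+
next
  assume "\<forall>i<n. \<forall>j<n. F (c $$ (i, j)) = H (d $$ (i, j))"
  then show "blk F c m = blk H d m"
    using c d by (intro eq_matI) (auto simp: blk_def less_mult_imp_div_less)
qed

lemma gen_Suc_eq_iff:
  assumes c: "c \<in> carrier_mat n n" and d: "d \<in> carrier_mat n n" and eq: "gen c k = gen d k"
  shows "gen c (Suc k) = gen d (Suc k) \<longleftrightarrow>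
    (\<forall>i<n. \<forall>j<n. tile (gen c k) (c $$ (i, j)) = tile (gen c k) (d $$ (i, j)))"
  unfolding gen_Suc_blk[OF c] gen_Suc_blk[OF d] eq[symmetric]
  by (rule blk_eq_iff[OF c d tile_carrier tile_carrier]) (rule gen_carrier[OF c])+

text \<open>Transposing a block matrix moves block \<open>(j, i)\<close> to \<open>(i, j)\<close>
  and transposes it there.\<close>

lemma gen_Suc_fixed_iff:
  assumes c: "c \<in> carrier_mat n n"
  shows "transform K1 (gen c (Suc k)) = gen c (Suc k) \<longleftrightarrow>
    (\<forall>i<n. \<forall>j<n. transform K1 (tile (gen c k) (c $$ (j, i))) = tile (gen c k) (c $$ (i, j)))"
proof -
  note t = tile_carrier[OF gen_carrier[OF c]]
  have K: "transform K1 c \<in> carrier_mat n n"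
    using c by (rule transform_carrier)
  show ?thesis
    unfolding gen_Suc_blk[OF c] transform_blk[OF c t]
      blk_eq_iff[OF K c transform_carrier[OF t] t]
    using c by (simp add: transform_K1 del: transform.simps)
qed

lemma gen_0_eq_0_iff:
  "c \<in> carrier_mat n m \<Longrightarrow> i < n \<Longrightarrow> j < m \<Longrightarrow> gen c 0 $$ (i, j) = 0 \<longleftrightarrow> c $$ (i, j) = None"
  by (auto split: option.split)

lemma gen_0_eq_iff:
  assumes c: "c \<in> carrier_mat n n" and d: "d \<in> carrier_mat n n"
  shows "gen c 0 = gen d 0 \<longleftrightarrow> (\<forall>i<n. \<forall>j<n. c $$ (i, j) = None \<longleftrightarrow> d $$ (i, j) = None)"
proof
  assume "gen c 0 = gen d 0"
  then show "\<forall>i<n. \<forall>j<n. c $$ (i, j) = None \<longleftrightarrow> d $$ (i, j) = None"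
    using gen_0_eq_0_iff[OF c] gen_0_eq_0_iff[OF d] by metis
next
  assume "\<forall>i<n. \<forall>j<n. c $$ (i, j) = None \<longleftrightarrow> d $$ (i, j) = None"
  then show "gen c 0 = gen d 0"
    using c d by (intro eq_matI) (auto split: option.splits, metis option.exhaust)
qed

lemma gen_0_K1_iff:
  assumes c: "c \<in> carrier_mat n n"
  shows "transform K1 (gen c 0) = gen c 0 \<longleftrightarrow>
    (\<forall>i<n. \<forall>j<n. c $$ (j, i) = None \<longleftrightarrow> c $$ (i, j) = None)"
proof -
  have K: "transform K1 c \<in> carrier_mat n n"
    using c by (rule transform_carrier)
  \<comment> \<open>\<open>transform K1 c\<close> moves the entries without conjugating them, unlike
    \<open>act K1 c\<close>; at level 0 only the zero positions are visible, so this
    suffices.\<close>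
  have "transform K1 (gen c 0) = gen (transform K1 c) 0"
    by (simp add: transform_map[OF c] del: transform.simps)
  then show ?thesis
    using c gen_0_eq_iff[OF K c] by (simp add: transform_K1 del: transform.simps gen.simps)
qed

lemma gen_0_K3_iff:
  assumes c: "c \<in> carrier_mat n n"
  shows "transform K3 (gen c 0) = gen c 0 \<longleftrightarrow>
    (\<forall>i<n. \<forall>j<n. c $$ (n - 1 - j, n - 1 - i) = None \<longleftrightarrow> c $$ (i, j) = None)"
proof -
  have K: "transform K3 c \<in> carrier_mat n n"
    using c by (rule transform_carrier)
  have "transform K3 (gen c 0) = gen (transform K3 c) 0"
    by (simp add: transform_map[OF c] del: transform.simps)
  then show ?thesis
    using gen_0_eq_iff[OF K c] by (simp add: transform_K3[OF c] del: transform.simps gen.simps)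
qed

section \<open>Configurations symmetric with respect to the principal diagonal only\<close>

text \<open>For \<open>n = 3\<close> this is one half of \<open>DS\<close>; a quarter turn carries
  it to the other half.\<close>

definition symmetric_configs :: "nat \<Rightarrow> config set" where
  "symmetric_configs n = {c \<in> carrier_mat n n.
     transform K1 (gen c 0) = gen c 0 \<and> transform K3 (gen c 0) \<noteq> gen c 0}"

text \<open>A finite condition on cosets equivalent to \<open>K1\<close> fixing every generated
  matrix (\<open>gen_fixed\<close>, \<open>fully_symmetricI\<close>): reflecting a tile of coset r
  turns it into one of coset r inverse.\<close>

definition fully_symmetric_configs :: "nat \<Rightarrow> config set" where
  "fully_symmetric_configs n = {c \<in> symmetric_configs n. \<forall>i<n. \<forall>j<n.
     map_option rotation_part (c $$ (i, j)) = map_option (reverse \<circ> rotation_part) (c $$ (j, i))}"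

definition rotation_configs :: "nat \<Rightarrow> config set" where
  "rotation_configs n = {c \<in> fully_symmetric_configs n. map_mat (map_option rotation_part) c = c}"

lemma symmetric_configsD:
  assumes "c \<in> symmetric_configs n"
  shows "c \<in> carrier_mat n n" "transform K1 (gen c 0) = gen c 0" "transform K3 (gen c 0) \<noteq> gen c 0"
  using assms unfolding symmetric_configs_def by blast+

lemma fully_symmetric_configsD:
  assumes "c \<in> fully_symmetric_configs n"
  shows "c \<in> symmetric_configs n"
    "i < n \<Longrightarrow> j < n \<Longrightarrow>
      map_option rotation_part (c $$ (i, j)) = map_option (reverse \<circ> rotation_part) (c $$ (j, i))"
  using assms unfolding fully_symmetric_configs_def by blast+

lemma rotation_part_tile:
  assumes "transform K1 A = A"
  shows "tile A (map_option rotation_part x) = tile A x"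
  using transform_rotation_part[OF assms] by (simp add: tile_def split: option.split)

lemma reverse_tile:
  assumes "transform K1 A = A" and "A \<in> carrier_mat m m"
  shows "transform K1 (tile A x) = tile A (map_option (reverse \<circ> rotation_part) x)"
  using transform_reverse[OF assms(1)] assms(2)
  by (simp add: tile_def transform_zero del: transform.simps split: option.split)

lemma tile_eq_imp:
  assumes "transform K1 A = A" and "transform K3 A \<noteq> A"
    and "tile A x = tile A y" and "x = None \<longleftrightarrow> y = None"
  shows "map_option rotation_part x = map_option rotation_part y"
proof (cases x)
  case (Some S)
  then obtain T where T: "y = Some T"
    using assms(4) by blast
  have "transform S A = transform T A"
    using assms(3) by (simp add: Some T tile_def)
  then have "rotation_part S = rotation_part T"
    by (rule transform_inj_rotation_part[OF assms(1,2)])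
  then show ?thesis
    by (simp add: Some T)
qed (use assms(4) in simp)

text \<open>Once \<open>K1\<close> fixes \<open>gen c k\<close>, a tile depends only on the coset of
  its entry, and the coset condition becomes the block condition for symmetry at the next
  level.\<close>

lemma gen_fixed:
  assumes c: "c \<in> fully_symmetric_configs n"
  shows "transform K1 (gen c k) = gen c k"
proof (induction k)
  case 0
  show ?case
    by (rule symmetric_configsD(2)[OF fully_symmetric_configsD(1)[OF c]])
next
  case (Suc k)
  have car: "c \<in> carrier_mat n n"
    by (rule symmetric_configsD(1)[OF fully_symmetric_configsD(1)[OF c]])
  have "transform K1 (tile (gen c k) (c $$ (j, i))) = tile (gen c k) (c $$ (i, j))" if "i < n" "j < n" for i j
    using reverse_tile[OF Suc gen_carrier[OF car]] rotation_part_tile[OF Suc]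
      fully_symmetric_configsD(2)[OF c that] by metis
  then show ?case
    using gen_Suc_fixed_iff[OF car] by blast
qed

text \<open>The initial tile has stabilizer \<open>{R0, K1}\<close>, so the blocks of
  \<open>gen c 1\<close> determine the cosets of the entries; symmetry at level 1 is therefore a
  statement about these cosets.\<close>

lemma fully_symmetricI:
  assumes c: "c \<in> symmetric_configs n" and fix1: "transform K1 (gen c 1) = gen c 1"
  shows "c \<in> fully_symmetric_configs n"
proof -
  note car = symmetric_configsD(1)[OF c] and K1 = symmetric_configsD(2)[OF c]
    and K3 = symmetric_configsD(3)[OF c]
  have "map_option rotation_part (c $$ (i, j)) = map_option (reverse \<circ> rotation_part) (c $$ (j, i))"
    if ij: "i < n" "j < n" for i j
  proof -
    have "tile (gen c 0) (c $$ (i, j)) = transform K1 (tile (gen c 0) (c $$ (j, i)))"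
      using fix1 ij gen_Suc_fixed_iff[OF car, of 0] by (metis One_nat_def)
    also have "\<dots> = tile (gen c 0) (map_option (reverse \<circ> rotation_part) (c $$ (j, i)))"
      by (rule reverse_tile[OF K1 gen_carrier[OF car]])
    finally have "map_option rotation_part (c $$ (i, j)) =
        map_option rotation_part (map_option (reverse \<circ> rotation_part) (c $$ (j, i)))"
      using K1 gen_0_K1_iff[OF car] ij by (intro tile_eq_imp[OF K1 K3]) auto
    moreover have "rotation_part (reverse (rotation_part x)) = reverse (rotation_part x)" for x
      by (cases x) auto
    ultimately show ?thesis
      by (simp add: option.map_comp o_def)
  qed
  then show ?thesis
    using c unfolding fully_symmetric_configs_def by blast
qed

text \<open>Levels 0 and 1 suffice: the first shows the zero positions, the second the cosets of the
  other entries.\<close>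

lemma identical_imp_rotation_part_eq:
  assumes c: "c \<in> symmetric_configs n" and d: "d \<in> carrier_mat n n" and "identical c d"
  shows "map_mat (map_option rotation_part) c = map_mat (map_option rotation_part) d"
proof -
  note car = symmetric_configsD(1)[OF c] and K1 = symmetric_configsD(2)[OF c]
    and K3 = symmetric_configsD(3)[OF c]
  have eq: "gen c k = gen d k" for k
    using \<open>identical c d\<close> by (simp add: identical_def)
  have "map_option rotation_part (c $$ (i, j)) = map_option rotation_part (d $$ (i, j))"
    if "i < n" "j < n" for i j
  proof (rule tile_eq_imp[OF K1 K3])
    show "tile (gen c 0) (c $$ (i, j)) = tile (gen c 0) (d $$ (i, j))"
      using iffD1[OF gen_Suc_eq_iff[OF car d eq] eq] that by blast
    show "c $$ (i, j) = None \<longleftrightarrow> d $$ (i, j) = None"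
      using iffD1[OF gen_0_eq_iff[OF car d] eq] that by blast
  qed
  then show ?thesis
    using car d by (intro eq_matI) auto
qed

lemma identical_imp_eq_or_fully_symmetric:
  assumes c: "c \<in> symmetric_configs n" and d: "d \<in> carrier_mat n n"
    and id: "identical c d" and "c \<noteq> d"
  shows "c \<in> fully_symmetric_configs n"
proof -
  note car = symmetric_configsD(1)[OF c]
  have eq: "gen c k = gen d k" for k
    using id by (simp add: identical_def)
  obtain i j where ij: "i < n" "j < n" and ne: "c $$ (i, j) \<noteq> d $$ (i, j)"
    using \<open>c \<noteq> d\<close> car d by (metis carrier_matD eq_matI)
  have "map_option rotation_part (c $$ (i, j)) = map_option rotation_part (d $$ (i, j))"
    using arg_cong[OF identical_imp_rotation_part_eq[OF c d id], of "\<lambda>A. A $$ (i, j)"] ij car d by simp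
  then obtain x y where xy: "c $$ (i, j) = Some x" "d $$ (i, j) = Some y" "x \<noteq> y"
    "rotation_part x = rotation_part y"
    using ne by (cases "c $$ (i, j)"; cases "d $$ (i, j)") auto
  \<comment> \<open>This uses equality at level 2, whose blocks are images of
    \<open>gen c 1\<close>. Two elements of one coset that act alike on \<open>gen c 1\<close> force
    \<open>K1\<close> to fix it.\<close>
  have "tile (gen c 1) (c $$ (i, j)) = tile (gen c 1) (d $$ (i, j))"
    using iffD1[OF gen_Suc_eq_iff[OF car d eq] eq] ij by blast
  then have "transform K1 (gen c 1) = gen c 1"
    using xy by (intro transform_eq_imp_fixed[of x _ y]) (simp_all add: tile_def del: gen.simps One_nat_def)
  then show ?thesis
    by (rule fully_symmetricI[OF c])
qed

text \<open>Since \<open>K1\<close> fixes every \<open>gen c k\<close>, replacing an entry by the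
  rotation in its coset changes no tile at any level.\<close>

lemma identical_rotation_part:
  assumes c: "c \<in> fully_symmetric_configs n"
  shows "identical c (map_mat (map_option rotation_part) c)"
  unfolding identical_def
proof
  fix k
  let ?d = "map_mat (map_option rotation_part) c"
  have car: "c \<in> carrier_mat n n"
    by (rule symmetric_configsD(1)[OF fully_symmetric_configsD(1)[OF c]])
  then have d: "?d \<in> carrier_mat n n" by simp
  show "gen c k = gen ?d k"
  proof (induction k)
    case 0
    show ?case
      using gen_0_eq_iff[OF car d] car by (simp del: gen.simps)
  next
    case (Suc k)
    show ?case
      using gen_Suc_eq_iff[OF car d Suc] rotation_part_tile[OF gen_fixed[OF c]] car
      by (simp del: gen.simps)
  qed
qed

lemma rotation_part_mem:
  assumes c: "c \<in> fully_symmetric_configs n"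
  shows "map_mat (map_option rotation_part) c \<in> rotation_configs n"
proof -
  let ?d = "map_mat (map_option rotation_part) c"
  note sym = fully_symmetric_configsD(1)[OF c]
  note car = symmetric_configsD(1)[OF sym]
  have idem: "map_option rotation_part (map_option rotation_part x) = map_option rotation_part x" for x
    by (simp add: option.map_comp o_def rotation_part_idem)
  have "gen c 0 = gen ?d 0"
    using identical_rotation_part[OF c] unfolding identical_def by blast
  then have "?d \<in> symmetric_configs n"
    using symmetric_configsD[OF sym] unfolding symmetric_configs_def mem_Collect_eq
    by (simp only: map_carrier_mat simp_thms)
  moreover have "map_option rotation_part (?d $$ (i, j)) =
      map_option (reverse \<circ> rotation_part) (?d $$ (j, i))" if "i < n" "j < n" for i j
  proof -
    have "map_option rotation_part (?d $$ (i, j)) = map_option rotation_part (c $$ (i, j))"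
      using car that by (simp add: idem)
    also have "\<dots> = map_option (reverse \<circ> rotation_part) (c $$ (j, i))"
      by (rule fully_symmetric_configsD(2)[OF c that])
    also have "\<dots> = map_option (reverse \<circ> rotation_part) (?d $$ (j, i))"
      using car that by (simp add: option.map_comp o_def rotation_part_idem)
    finally show ?thesis .
  qed
  moreover have "map_mat (map_option rotation_part) ?d = ?d"
    by (intro eq_matI) (simp_all add: idem)
  ultimately show ?thesis
    unfolding rotation_configs_def fully_symmetric_configs_def by blast
qed

section \<open>Counting configurations\<close>

definition opt_entries :: "sym set \<Rightarrow> sym option set" where
  "opt_entries D = insert None (Some ` D)"

definition opt_pairs :: "('a \<times> 'a) set \<Rightarrow> ('a option \<times> 'a option) set" where
  "opt_pairs E = {(u, v). rel_option (\<lambda>x y. (x, y) \<in> E) u v}"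

text \<open>
  The negated condition says that the zero set is not symmetric with respect to the second diagonal,
  given that it is symmetric with respect to the principal one.
\<close>

definition patterned :: "sym set \<Rightarrow> (sym \<times> sym) set \<Rightarrow> config set" where
  "patterned D E = {c \<in> carrier_mat 3 3.
     (\<forall>i<3. c $$ (i, i) \<in> opt_entries D) \<and> (\<forall>i<3. \<forall>j<i. (c $$ (j, i), c $$ (i, j)) \<in> opt_pairs E) \<and>
     \<not> ((c $$ (0, 0) = None \<longleftrightarrow> c $$ (2, 2) = None) \<and> (c $$ (0, 1) = None \<longleftrightarrow> c $$ (1, 2) = None))}"

lemma all_less_3: "(\<forall>i<3. P i) \<longleftrightarrow> P 0 \<and> P 1 \<and> P (2 :: nat)"
  by (auto simp: numeral_eq_Suc less_Suc_eq)

lemma all_less_2: "(\<forall>i<2. P i) \<longleftrightarrow> P 0 \<and> P (1 :: nat)"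
  by (auto simp: numeral_eq_Suc less_Suc_eq)

lemma all_less_1: "(\<forall>i<1. P i) \<longleftrightarrow> P (0 :: nat)"
  by auto

lemma card_opt_entries: "finite D \<Longrightarrow> card (opt_entries D) = Suc (card D)"
  by (simp add: opt_entries_def card_insert_if card_image)

lemma finite_opt_entries: "finite D \<Longrightarrow> finite (opt_entries D)"
  by (simp add: opt_entries_def)

lemma opt_pairs_eq: "opt_pairs E = insert (None, None) (map_prod Some Some ` E)"
  by (auto simp: opt_pairs_def elim!: option.rel_cases)

lemma card_opt_pairs: "finite E \<Longrightarrow> card (opt_pairs E) = Suc (card E)"
  by (subst opt_pairs_eq, subst card_insert_disjoint) (auto simp: inj_on_def intro!: card_image)

lemma finite_opt_pairs: "finite E \<Longrightarrow> finite (opt_pairs E)"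
  by (simp add: opt_pairs_eq)

type_synonym entries = "sym option \<times> (sym option \<times> sym option) \<times> (sym option \<times> sym option) \<times>
  (sym option \<times> sym option) \<times> (sym option \<times> sym option)"

text \<open>The grouping follows the two diagonal reflections. The one in the principal diagonal
  fixes the first three entries and swaps the members of each later pair; the one in the second
  diagonal swaps the two corners \<open>(0, 0)\<close> and \<open>(2, 2)\<close> and exchanges zero
  patterns between the last two pairs.\<close>

definition entries_of :: "config \<Rightarrow> entries" where
  "entries_of c = (c $$ (1, 1), (c $$ (0, 0), c $$ (2, 2)), (c $$ (0, 2), c $$ (2, 0)),
     (c $$ (0, 1), c $$ (1, 0)), (c $$ (1, 2), c $$ (2, 1)))"

lemma bij_entries_of: "bij_betw entries_of (carrier_mat 3 3) UNIV"
  unfolding bij_betw_def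
proof (intro conjI inj_onI Set.set_eqI iffI)
  fix c d
  assume cd: "c \<in> carrier_mat 3 3" "d \<in> carrier_mat 3 3" and eq: "entries_of c = entries_of d"
  have "\<forall>i<3. \<forall>j<3. c $$ (i, j) = d $$ (i, j)"
    using eq by (simp add: all_less_3 entries_of_def)
  then show "c = d"
    using cd by (intro eq_matI) auto
next
  fix t :: entries
  obtain a b1 b2 p1 p2 q1 q2 r1 r2 where t: "t = (a, (b1, b2), (p1, p2), (q1, q2), (r1, r2))"
    by (metis prod.exhaust)
  let ?c = "mat 3 3 (\<lambda>(i, j). [[b1, q1, p1], [q2, a, r1], [p2, r2, b2]] ! i ! j)"
  have "entries_of ?c = t"
    by (simp add: entries_of_def t numeral_2_eq_2)
  then show "t \<in> entries_of ` carrier_mat 3 3"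
    by (metis image_eqI mat_carrier)
qed simp

lemma bij_betw_vimage:
  assumes "bij_betw f A UNIV"
  shows "bij_betw f {x \<in> A. f x \<in> Y} Y"
proof -
  have "inj_on f {x \<in> A. f x \<in> Y}"
    using bij_betw_imp_inj_on[OF assms] by (rule inj_on_subset) simp
  moreover have "f ` {x \<in> A. f x \<in> Y} = f ` A \<inter> Y"
    by blast
  ultimately show ?thesis
    using bij_betw_imp_surj_on[OF assms] by (simp add: bij_betw_def)
qed

text \<open>From all admissible choices of entries those are removed whose zero set is also
  symmetric in the second diagonal. Requiring two quantities to vanish together replaces
  \<open>Suc (card D) ^ 2\<close> by \<open>Suc (card D ^ 2)\<close>, and likewise for
  \<open>E\<close>.\<close>

lemma card_patterned:
  assumes D: "finite D" and E: "finite E"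
  shows "card (patterned D E) =
    Suc (card D) ^ 3 * Suc (card E) ^ 3 -
    Suc (card D) * Suc (card D ^ 2) * Suc (card E) * Suc (card E ^ 2)"
proof -
  define all where "all = opt_entries D \<times> (opt_entries D \<times> opt_entries D) \<times> opt_pairs E \<times> (opt_pairs E \<times> opt_pairs E)"
  define double where "double = insert ((None, None), (None, None))
    (map_prod (map_prod Some Some) (map_prod Some Some) ` (E \<times> E))"
  \<comment> \<open>\<open>opt_pairs (D \<times> D)\<close> makes the two corners vanish together
    and leaves them otherwise unrelated; \<open>double\<close> does the same for the last two
    pairs.\<close>
  define bad where "bad = opt_entries D \<times> opt_pairs (D \<times> D) \<times> opt_pairs E \<times> double"
  have fin: "finite bad"
    using D E by (simp add: bad_def double_def finite_opt_entries finite_opt_pairs)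
  have "card double = Suc (card E ^ 2)"
    unfolding double_def using E
    by (subst card_insert_disjoint, simp, force)
      (subst card_image, auto simp: inj_on_def card_cartesian_product power2_eq_square)
  then have card_bad: "card bad = Suc (card D) * Suc (card D ^ 2) * Suc (card E) * Suc (card E ^ 2)"
    using D E by (simp add: bad_def card_cartesian_product card_opt_entries card_opt_pairs power2_eq_square mult_ac
        del: mult_Suc mult_Suc_right)
  have card_all: "card all = Suc (card D) ^ 3 * Suc (card E) ^ 3"
    using D E by (simp add: all_def card_cartesian_product card_opt_entries card_opt_pairs power3_eq_cube mult_ac
        del: mult_Suc mult_Suc_right)
  have double_iff: "(q, r) \<in> double \<longleftrightarrow>
      q \<in> opt_pairs E \<and> r \<in> opt_pairs E \<and> (fst q = None \<longleftrightarrow> fst r = None)" for q r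
  proof -
    have "((Some a, Some b), (Some c, Some d)) \<in> double \<longleftrightarrow> (a, b) \<in> E \<and> (c, d) \<in> E" for a b c d
      using inj_image_mem_iff[OF prod.inj_map[OF prod.inj_map prod.inj_map],
          OF inj_Some inj_Some inj_Some inj_Some, of "((a, b), (c, d))" "E \<times> E"]
      by (simp add: double_def)
    moreover have "((None, None), (None, None)) \<in> double" "((None, None), map_prod Some Some p) \<notin> double"
      "(map_prod Some Some p, (None, None)) \<notin> double" for p
      by (auto simp: double_def prod_eq_iff)
    moreover have "q \<in> opt_pairs E \<and> r \<in> opt_pairs E" if "(q, r) \<in> double"
      using that by (auto simp: double_def opt_pairs_eq)
    ultimately show ?thesis
      by (auto simp: opt_pairs_eq)
  qed
  have diag_iff: "(u, v) \<in> opt_pairs (D \<times> D) \<longleftrightarrow>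
      u \<in> opt_entries D \<and> v \<in> opt_entries D \<and> (u = None \<longleftrightarrow> v = None)" for u v
    by (auto simp: opt_pairs_eq opt_entries_def)
  have "bad \<subseteq> all"
    by (auto simp: bad_def all_def double_iff diag_iff)
  have "entries_of c \<in> all - bad \<longleftrightarrow>
     (\<forall>i<3. c $$ (i, i) \<in> opt_entries D) \<and> (\<forall>i<3. \<forall>j<i. (c $$ (j, i), c $$ (i, j)) \<in> opt_pairs E) \<and>
     \<not> ((c $$ (0, 0) = None \<longleftrightarrow> c $$ (2, 2) = None) \<and> (c $$ (0, 1) = None \<longleftrightarrow> c $$ (1, 2) = None))" for c
    unfolding entries_of_def all_def bad_def all_less_3 all_less_2 Diff_iff mem_Times_iff fst_conv snd_conv
      double_iff diag_iff all_less_1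
    by (simp add: all_less_1[unfolded One_nat_def] del: not_None_eq) argo
  then have "patterned D E = {c \<in> carrier_mat 3 3. entries_of c \<in> all - bad}"
    by (simp add: patterned_def)
  then have "bij_betw entries_of (patterned D E) (all - bad)"
    by (simp only: bij_betw_vimage[OF bij_entries_of])
  then have "card (patterned D E) = card (all - bad)"
    by (rule bij_betw_same_card)
  also have "\<dots> = card all - card bad"
    using fin \<open>bad \<subseteq> all\<close> by (rule card_Diff_subset)
  finally show ?thesis
    by (simp only: card_all card_bad)
qed

section \<open>The three families of configurations as instances of \<open>patterned\<close>\<close>

lemma opt_pairs_UNIV: "(u, v) \<in> opt_pairs UNIV \<longleftrightarrow> (u = None \<longleftrightarrow> v = None)"
  by (cases u; cases v) (auto simp: opt_pairs_def)

lemma opt_entries_UNIV: "opt_entries UNIV = UNIV"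
  by (auto simp: opt_entries_def intro: option.exhaust)

text \<open>Only the zero pattern is constrained. Given symmetry in the principal diagonal, symmetry
  in the second one reduces to one equivalence for the corners and one for the edge
  positions.\<close>

lemma symmetric_configs_eq: "symmetric_configs 3 = patterned UNIV UNIV"
proof (rule Set.set_eqI)
  fix c
  show "c \<in> symmetric_configs 3 \<longleftrightarrow> c \<in> patterned UNIV UNIV"
  proof (cases "c \<in> carrier_mat 3 3")
    case True
    show ?thesis
      unfolding symmetric_configs_def mem_Collect_eq gen_0_K1_iff[OF True] gen_0_K3_iff[OF True] patterned_def
        opt_pairs_UNIV opt_entries_UNIV all_less_3 all_less_2
      using True by (simp add: all_less_1[unfolded One_nat_def] del: not_None_eq) argo
  qed (simp add: symmetric_configs_def patterned_def)
qed

lemma map_option_eq_reverse_iff: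
  "map_option rotation_part u = map_option (reverse \<circ> rotation_part) v \<longleftrightarrow>
    (u, v) \<in> opt_pairs {(x, y). rotation_part x = reverse (rotation_part y)}"
  by (cases u; cases v) (auto simp: opt_pairs_def)

lemma reverse_rotation_part_sym:
  "rotation_part x = reverse (rotation_part y) \<longleftrightarrow> rotation_part y = reverse (rotation_part x)"
  by (cases x; cases y) auto

text \<open>The coset relation is symmetric, so one condition per pair of mirrored positions is
  enough; on the diagonal it restricts a single entry.\<close>

lemma fully_symmetric_configs_eq:
  "fully_symmetric_configs 3 = patterned {x. rotation_part x = reverse (rotation_part x)}
     {(x, y). rotation_part x = reverse (rotation_part y)}"
proof -
  let ?E = "{(x, y). rotation_part x = reverse (rotation_part y)}"
  have diag: "(u, u) \<in> opt_pairs ?E \<longleftrightarrow> u \<in> opt_entries {x. rotation_part x = reverse (rotation_part x)}" for u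
    by (cases u) (auto simp: opt_pairs_def opt_entries_def)
  have swap: "(u, v) \<in> opt_pairs ?E \<longleftrightarrow> (v, u) \<in> opt_pairs ?E" for u v
    using reverse_rotation_part_sym by (cases u; cases v) (auto simp: opt_pairs_def)
  have "(u, v) \<in> opt_pairs ?E \<Longrightarrow> (u, v) \<in> opt_pairs UNIV" for u v
    by (cases u; cases v) (auto simp: opt_pairs_def)
  then show ?thesis
    unfolding fully_symmetric_configs_def symmetric_configs_eq map_option_eq_reverse_iff patterned_def
      all_less_3 all_less_2 opt_entries_UNIV
    using diag swap by (auto simp: all_less_1[unfolded One_nat_def])
qed

lemma rotation_configs_eq:
  "rotation_configs 3 = patterned {x. rotation_part x = x \<and> x = reverse x}
     {(x, y). rotation_part x = x \<and> rotation_part y = y \<and> x = reverse y}"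
proof -
  have "map_mat (map_option rotation_part) c = c \<longleftrightarrow>
      (\<forall>i<3. \<forall>j<3. map_option rotation_part (c $$ (i, j)) = c $$ (i, j))"
    if "c \<in> carrier_mat 3 3" for c
    using that by (auto simp: mat_eq_iff)
  moreover have "u \<in> opt_entries {x. rotation_part x = x \<and> x = reverse x} \<longleftrightarrow>
      u \<in> opt_entries {x. rotation_part x = reverse (rotation_part x)} \<and> map_option rotation_part u = u" for u
    by (cases u) (auto simp: opt_entries_def)
  moreover have "(u, v) \<in> opt_pairs {(x, y). rotation_part x = x \<and> rotation_part y = y \<and> x = reverse y} \<longleftrightarrow>
      (u, v) \<in> opt_pairs {(x, y). rotation_part x = reverse (rotation_part y)} \<and>
      map_option rotation_part u = u \<and> map_option rotation_part v = v" for u v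
    by (cases u; cases v) (auto simp: opt_pairs_def)
  ultimately show ?thesis
    unfolding rotation_configs_def fully_symmetric_configs_eq patterned_def all_less_3 all_less_2
    by (auto simp: all_less_1[unfolded One_nat_def])
qed

lemma finite_sym [simp]: "finite (A :: sym set)"
  by (rule finite_subset[OF subset_UNIV]) (simp add: UNIV_sym)

lemma card_sym_set: "card {x. P x} = (\<Sum>x\<in>{R0, R1, R2, R3, K0, K1, K2, K3}. if P x then 1 else 0)"
  using sum.inter_filter[of "UNIV :: sym set" "\<lambda>_. 1 :: nat" P] by (simp add: UNIV_sym[symmetric])

lemma card_sym_rel: "card {(x :: sym, y :: sym). P x y} =
  (\<Sum>x\<in>{R0, R1, R2, R3, K0, K1, K2, K3}. card {y. P x y})"
proof -
  have "{(x, y). P x y} = (SIGMA x:UNIV. {y. P x y})"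
    by auto
  then show ?thesis
    by (simp only: card_SigmaI finite_sym UNIV_sym[symmetric] ball_UNIV simp_thms)
qed

lemma card_symmetric_configs: "card (symmetric_configs 3) = 44413200"
proof -
  have "card (UNIV :: sym set) = 8"
    by (simp add: UNIV_sym)
  moreover have "card (UNIV :: (sym \<times> sym) set) = 64"
    using calculation by (simp flip: UNIV_Times_UNIV add: card_cartesian_product)
  ultimately show ?thesis
    unfolding symmetric_configs_eq by (subst card_patterned) (simp_all flip: UNIV_Times_UNIV)
qed

lemma card_fully_symmetric_configs: "card (fully_symmetric_configs 3) = 242760"
proof -
  \<comment> \<open>On the diagonal the coset must be that of \<open>R0\<close> or
    \<open>R2\<close>, with two elements each. Off the diagonal one entry is free and fixes the
    coset of the other: 8 times 2.\<close>
  have "card {x. rotation_part x = reverse (rotation_part x)} = 4"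
    "card {(x, y). rotation_part x = reverse (rotation_part y)} = 16"
    by (simp_all add: card_sym_rel card_sym_set)
  moreover have "finite {(x, y). rotation_part x = reverse (rotation_part y)}"
    by (rule finite_subset[of _ "UNIV \<times> UNIV"]) (auto simp del: UNIV_Times_UNIV)
  ultimately show ?thesis
    unfolding fully_symmetric_configs_eq by (subst card_patterned) simp_all
qed

lemma card_rotation_configs: "card (rotation_configs 3) = 2100"
proof -
  \<comment> \<open>Now each coset contributes its rotation only: \<open>R0\<close> or
    \<open>R2\<close> on the diagonal, and a rotation with its inverse off it.\<close>
  have "card {x. rotation_part x = x \<and> x = reverse x} = 2"
    "card {(x, y). rotation_part x = x \<and> rotation_part y = y \<and> x = reverse y} = 4"
    by (simp_all add: card_sym_rel card_sym_set)
  moreover have "finite {(x, y). rotation_part x = x \<and> rotation_part y = y \<and> x = reverse y}"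
    by (rule finite_subset[of _ "UNIV \<times> UNIV"]) (auto simp del: UNIV_Times_UNIV)
  ultimately show ?thesis
    unfolding rotation_configs_eq by (subst card_patterned) simp_all
qed

section \<open>Classes and their stabilizers\<close>

lemma symmetric_configs_subset_DS: "symmetric_configs 3 \<subseteq> DS"
  by (auto simp: DS_iff symmetric_configs_def simp del: transform.simps gen.simps)

lemma rotation_configs_subset: "rotation_configs n \<subseteq> fully_symmetric_configs n"
  by (auto simp: rotation_configs_def)

lemma fully_symmetric_configs_subset: "fully_symmetric_configs n \<subseteq> symmetric_configs n"
  by (auto simp: fully_symmetric_configs_def)

lemma ident_class_eq_iff:
  assumes "c \<in> DS" "d \<in> DS"
  shows "ident_class c = ident_class d \<longleftrightarrow> identical c d"
proof
  assume "ident_class c = ident_class d"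
  moreover have "d \<in> ident_class d"
    using assms by (simp add: ident_class_def identical_def)
  ultimately show "identical c d"
    by (auto simp: ident_class_def)
qed (auto simp: ident_class_def identical_def)

definition representatives :: "config set" where
  "representatives = (symmetric_configs 3 - fully_symmetric_configs 3) \<union> rotation_configs 3"

lemma representatives_subset: "representatives \<subseteq> symmetric_configs 3"
  using rotation_configs_subset fully_symmetric_configs_subset by (auto simp: representatives_def)

text \<open>Distinct identical configurations are both fully symmetric, so as representatives they
  consist of rotations and zeros; having the same cosets, they coincide.\<close>

lemma inj_on_ident_class: "inj_on ident_class representatives"
proof (rule inj_onI, rule ccontr)
  fix c d
  assume cd: "c \<in> representatives" "d \<in> representatives"
    and eq: "ident_class c = ident_class d" and ne: "c \<noteq> d"
  have sym: "c \<in> symmetric_configs 3" "d \<in> symmetric_configs 3"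
    using cd representatives_subset by auto
  then have id: "identical c d"
    using eq ident_class_eq_iff symmetric_configs_subset_DS by blast
  then have id': "identical d c"
    by (simp add: identical_def)
  have "c \<in> fully_symmetric_configs 3" "d \<in> fully_symmetric_configs 3"
    using identical_imp_eq_or_fully_symmetric[OF sym(1) symmetric_configsD(1)[OF sym(2)] id ne]
      identical_imp_eq_or_fully_symmetric[OF sym(2) symmetric_configsD(1)[OF sym(1)] id'] ne
    by auto
  then have "c \<in> rotation_configs 3" "d \<in> rotation_configs 3"
    using cd by (auto simp: representatives_def)
  then show False
    using ne identical_imp_rotation_part_eq[OF sym(1) symmetric_configsD(1)[OF sym(2)] id]
    by (simp add: rotation_configs_def)
qed

lemma ident_class_rotation_part:
  assumes c: "c \<in> fully_symmetric_configs 3"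
  shows "ident_class c = ident_class (map_mat (map_option rotation_part) c)"
proof (subst ident_class_eq_iff)
  show "c \<in> DS"
    using c fully_symmetric_configs_subset symmetric_configs_subset_DS by blast
  show "map_mat (map_option rotation_part) c \<in> DS"
    using rotation_part_mem[OF c] rotation_configs_subset fully_symmetric_configs_subset
      symmetric_configs_subset_DS by blast
qed (rule identical_rotation_part[OF c])

lemma ident_class_representatives:
  "ident_class ` symmetric_configs 3 = ident_class ` representatives"
proof
  show "ident_class ` symmetric_configs 3 \<subseteq> ident_class ` representatives"
  proof
    fix C assume "C \<in> ident_class ` symmetric_configs 3"
    then obtain c where c: "c \<in> symmetric_configs 3" "C = ident_class c" by blast
    show "C \<in> ident_class ` representatives"
    proof (cases "c \<in> fully_symmetric_configs 3")
      case True
      then show ?thesis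
        using c ident_class_rotation_part rotation_part_mem by (auto simp: representatives_def)
    qed (use c in \<open>auto simp: representatives_def\<close>)
  qed
qed (use representatives_subset in blast)

section \<open>Classes fixed by each transformation\<close>

lemma act_class_ident_class:
  "c \<in> DS \<Longrightarrow> act_class T (ident_class c) = ident_class (act T c)"
  by (simp add: act_class_def DSR_ident_class act_ident_class)

text \<open>By \<open>gen_act\<close>, a class is fixed by \<open>T\<close> exactly when the pattern
  it generates is, which reduces fixed points to symmetry of matrices.\<close>

lemma act_class_fixed_iff:
  assumes c: "c \<in> DS"
  shows "act_class T (ident_class c) = ident_class c \<longleftrightarrow> (\<forall>k. transform T (gen c k) = gen c k)"
proof -
  have "c \<in> carrier_mat 3 3"
    using c by (simp add: DS_iff)
  then show ?thesis
    by (simp add: act_class_ident_class[OF c] ident_class_eq_iff[OF act_DS[OF c] c] identical_def gen_act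
        del: transform.simps gen.simps)
qed

lemma invariants_K1: "invariants DSR act_class K1 = ident_class ` rotation_configs 3"
proof
  show "invariants DSR act_class K1 \<subseteq> ident_class ` rotation_configs 3"
  proof
    fix C assume "C \<in> invariants DSR act_class K1"
    then obtain c where c: "c \<in> DS" "C = ident_class c" and "act_class K1 C = C"
      by (auto simp: invariants_def DSR_ident_class)
    then have fixed: "transform K1 (gen c k) = gen c k" for k
      using act_class_fixed_iff by blast
    \<comment> \<open>Exactly one diagonal reflection fixes the initial tile of an element of
      \<open>DS\<close>; as \<open>K1\<close> does, \<open>K3\<close> does not.\<close>
    then have "c \<in> symmetric_configs 3"
      using c(1) unfolding DS_iff symmetric_configs_def by blast
    then have "c \<in> fully_symmetric_configs 3"
      using fixed by (rule fully_symmetricI)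
    then show "C \<in> ident_class ` rotation_configs 3"
      using c(2) ident_class_rotation_part rotation_part_mem by blast
  qed
next
  show "ident_class ` rotation_configs 3 \<subseteq> invariants DSR act_class K1"
  proof
    fix C assume "C \<in> ident_class ` rotation_configs 3"
    then obtain c where c: "c \<in> fully_symmetric_configs 3" "C = ident_class c"
      using rotation_configs_subset by blast
    then have "c \<in> DS"
      using fully_symmetric_configs_subset symmetric_configs_subset_DS by blast
    moreover from this have "act_class K1 (ident_class c) = ident_class c"
      using gen_fixed[OF c(1)] act_class_fixed_iff by blast
    ultimately show "C \<in> invariants DSR act_class K1"
      unfolding invariants_def DSR_ident_class c(2) by blast
  qed
qed

text \<open>The initial tile already decides. If a diagonal reflection fixes it, then modulo that
  reflection \<open>T\<close> acts on it as a nontrivial rotation, so the half turn fixes it. The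
  half turn times one diagonal reflection is the other, contradicting membership in
  \<open>DS\<close>.\<close>

lemma invariants_eq_empty:
  assumes "T \<notin> {R0, K1, K3}"
  shows "invariants DSR act_class T = {}"
proof (rule ccontr)
  assume "invariants DSR act_class T \<noteq> {}"
  then obtain c where c: "c \<in> DS" and fixed: "transform T (gen c 0) = gen c 0"
    using act_class_fixed_iff by (auto simp: invariants_def DSR_ident_class simp del: transform.simps gen.simps)
  define A where "A = gen c 0"
  have half: "rot (rot A) = A" if "rot A = A \<or> rot (rot (rot A)) = A"
    using that rot4 by metis
  have "transform K1 A = A \<longleftrightarrow> transform K3 A = A"
  proof
    assume K1: "transform K1 A = A"
    then have "transform (rotation_part T) A = A"
      using fixed transform_rotation_part unfolding A_def by metis
    then have "rot (rot A) = A"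
      using assms half by (cases T) simp_all
    then show "transform K3 A = A"
      using K1 by simp
  next
    assume K3: "transform K3 A = A"
    then have m: "mirror A = rot (rot (rot A))"
      by (metis mirror2 o_apply transform.simps(8))
    have "rot A = A \<or> rot (rot A) = A \<or> rot (rot (rot A)) = A"
      using fixed[folded A_def] assms by (cases T) (simp_all add: mirror_rot rot4 m)
    then have "rot (rot A) = A"
      using half by blast
    then show "transform K1 A = A"
      using K3 by simp
  qed
  then show False
    using c unfolding DS_iff A_def by blast
qed

lemma sym_mult_eqI:
  "(\<And>A :: nat mat. transform U A = transform S (transform T A)) \<Longrightarrow> S \<otimes>\<^bsub>G\<^esub> T = U"
  by (intro transform_inject ext) (simp add: G_def transform_sym_mult)

text \<open>Conjugation by \<open>R1\<close> carries \<open>K1\<close> to \<open>K3\<close>; the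
  inverses are cleared so that the equations apply directly to products of actions.\<close>

lemma conjugate_R1:
  "K3 \<otimes>\<^bsub>G\<^esub> R1 = R1 \<otimes>\<^bsub>G\<^esub> K1" "K1 \<otimes>\<^bsub>G\<^esub> R3 = R3 \<otimes>\<^bsub>G\<^esub> K3" "R1 \<otimes>\<^bsub>G\<^esub> R3 = \<one>\<^bsub>G\<^esub>"
proof -
  have "K3 \<otimes>\<^bsub>G\<^esub> R1 = K0" "R1 \<otimes>\<^bsub>G\<^esub> K1 = K0" "K1 \<otimes>\<^bsub>G\<^esub> R3 = K0" "R3 \<otimes>\<^bsub>G\<^esub> K3 = K0" "R1 \<otimes>\<^bsub>G\<^esub> R3 = R0"
    by (rule sym_mult_eqI, simp add: mirror_rot rot4)+
  then show "K3 \<otimes>\<^bsub>G\<^esub> R1 = R1 \<otimes>\<^bsub>G\<^esub> K1" "K1 \<otimes>\<^bsub>G\<^esub> R3 = R3 \<otimes>\<^bsub>G\<^esub> K3" "R1 \<otimes>\<^bsub>G\<^esub> R3 = \<one>\<^bsub>G\<^esub>"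
    by (simp_all add: G_def)
qed

lemma in_carrier_G: "T \<in> carrier G"
  by (simp add: G_def)

text \<open>Conjugate elements have equally many fixed points: \<open>R1\<close> maps the classes
  fixed by \<open>K1\<close> bijectively onto those fixed by \<open>K3\<close>.\<close>

lemma card_invariants_K3: "card (invariants DSR act_class K3) = card (invariants DSR act_class K1)"
proof -
  interpret group_action G DSR act_class
    by (rule group_action_DSR)
  note comp = composition_rule[OF _ in_carrier_G in_carrier_G]
  have mem: "act_class T C \<in> DSR" if "C \<in> DSR" for T C
    using element_image[OF in_carrier_G that] by blast
  have "act_class R1 ` invariants DSR act_class K1 = invariants DSR act_class K3"
  proof (intro subset_antisym subsetI)
    fix C assume "C \<in> act_class R1 ` invariants DSR act_class K1"
    then obtain D where D: "D \<in> DSR" "act_class K1 D = D" "C = act_class R1 D"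
      by (auto simp: invariants_def)
    then have "act_class K3 C = C"
      using comp[OF D(1)] conjugate_R1(1) by metis
    then show "C \<in> invariants DSR act_class K3"
      using D mem by (simp add: invariants_def)
  next
    fix C assume C: "C \<in> invariants DSR act_class K3"
    then have D: "C \<in> DSR" "act_class K3 C = C"
      by (auto simp: invariants_def)
    have "act_class K1 (act_class R3 C) = act_class R3 C"
      using D comp[OF D(1)] conjugate_R1(2) by metis
    moreover have "act_class R1 (act_class R3 C) = C"
      using D(1) comp[OF D(1)] conjugate_R1(3) id_eq_one by (metis restrict_apply')
    ultimately show "C \<in> act_class R1 ` invariants DSR act_class K1"
      using mem D(1) by (intro image_eqI[of _ _ "act_class R3 C"]) (auto simp: invariants_def)
  qed
  moreover have "inj_on (act_class R1) (invariants DSR act_class K1)"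
    using inj_prop[OF in_carrier_G] by (rule inj_on_subset) (auto simp: invariants_def)
  ultimately show ?thesis
    by (metis card_image)
qed

section \<open>The two halves of \<open>DSR\<close> and the final count\<close>

lemma DSR_decomposition:
  defines "S \<equiv> ident_class ` symmetric_configs 3"
  shows "DSR = S \<union> act_class R1 ` S" and "S \<inter> act_class R1 ` S = {}"
proof -
  have car: "c \<in> carrier_mat 3 3" if "c \<in> DS" for c
    using that by (simp add: DS_iff)
  have K: "transform K1 (transform R3 A) = transform R3 (transform K3 A)"
    "transform K3 (transform R3 A) = transform R3 (transform K1 A)"
    "transform K1 (transform R1 A) = transform R1 (transform K3 A)" for A :: "nat mat"
    by (simp_all add: mirror_rot rot4)
  have S_subset: "S \<subseteq> DSR"
    using symmetric_configs_subset_DS by (auto simp: S_def DSR_ident_class)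
  have "C \<in> S \<union> act_class R1 ` S" if C: "C \<in> DSR" for C
  proof -
    obtain c where c: "c \<in> DS" "C = ident_class c"
      using C unfolding DSR_ident_class by blast
    show ?thesis
    proof (cases "c \<in> symmetric_configs 3")
      case False
      then have "transform K3 (gen c 0) = gen c 0" "transform K1 (gen c 0) \<noteq> gen c 0"
        using c(1) unfolding DS_iff symmetric_configs_def by blast+
      \<comment> \<open>Rotating by \<open>R3\<close> exchanges the diagonals and lands in the first
        half; \<open>R1\<close> then recovers the class.\<close>
      then have "act R3 c \<in> symmetric_configs 3"
        using act_carrier[OF car[OF c(1)]]
        by (simp add: symmetric_configs_def gen_act[OF car[OF c(1)]] K transform_eq_iff
            del: transform.simps gen.simps)
      moreover have "act_class R1 (ident_class (act R3 c)) = C"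
        using c act_DS act_mult[OF car[OF c(1)], of R1 R3] conjugate_R1(3) act_one
        by (simp add: act_class_ident_class)
      ultimately show ?thesis
        by (auto simp: S_def)
    qed (use c in \<open>auto simp: S_def\<close>)
  qed
  moreover have "act_class R1 ` S \<subseteq> DSR"
    using S_subset group_action.surj_prop[OF group_action_DSR in_carrier_G] by blast
  ultimately show "DSR = S \<union> act_class R1 ` S"
    using S_subset by blast
  have False if c: "c \<in> symmetric_configs 3" and d: "d \<in> symmetric_configs 3"
    and eq: "ident_class c = act_class R1 (ident_class d)" for c d
  proof -
    have DS: "c \<in> DS" "d \<in> DS"
      using c d symmetric_configs_subset_DS by auto
    then have "gen c 0 = transform R1 (gen d 0)"
      using eq by (simp add: act_class_ident_class ident_class_eq_iff act_DS identical_def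
        gen_act[OF car] del: transform.simps gen.simps)
    \<comment> \<open>\<open>K1\<close> fixes \<open>gen c 0\<close>; moved past \<open>R1\<close>
      it becomes \<open>K3\<close>, which would then fix \<open>gen d 0\<close>.\<close>
    then have "transform R1 (transform K3 (gen d 0)) = transform R1 (gen d 0)"
      using symmetric_configsD(2)[OF c] K(3) by metis
    then show False
      using symmetric_configsD(3)[OF d] by (simp add: transform_eq_iff del: transform.simps gen.simps)
  qed
  then show "S \<inter> act_class R1 ` S = {}"
    by (auto simp: S_def)
qed


lemma card_ident_classes: "card (ident_class ` symmetric_configs 3) = 44172540"
proof -
  \<comment> \<open>An infinite set has \<open>card\<close> 0, so the positive count gives
    finiteness.\<close>
  have fin: "finite (symmetric_configs 3)"
    using card_symmetric_configs by (intro card_ge_0_finite) simp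
  have sub: "rotation_configs 3 \<subseteq> fully_symmetric_configs 3" "fully_symmetric_configs 3 \<subseteq> symmetric_configs 3"
    by (rule rotation_configs_subset fully_symmetric_configs_subset)+
  have fin': "finite (fully_symmetric_configs 3)"
    by (rule finite_subset[OF sub(2) fin])
  then have "finite (rotation_configs 3)"
    by (rule finite_subset[OF sub(1)])
  note fin' = this fin'
  have "card (ident_class ` symmetric_configs 3) = card representatives"
    unfolding ident_class_representatives by (rule card_image[OF inj_on_ident_class])
  also have "\<dots> = card (symmetric_configs 3 - fully_symmetric_configs 3) + card (rotation_configs 3)"
    unfolding representatives_def using sub fin fin' by (intro card_Un_disjoint) auto
  also have "card (symmetric_configs 3 - fully_symmetric_configs 3) =
      card (symmetric_configs 3) - card (fully_symmetric_configs 3)"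
    using sub fin' by (intro card_Diff_subset)
  finally show ?thesis
    by (simp add: card_symmetric_configs card_fully_symmetric_configs card_rotation_configs)
qed

lemma finite_DSR: "finite DSR" and card_DSR: "card DSR = 88345080"
proof -
  let ?S = "ident_class ` symmetric_configs 3"
  have fin: "finite ?S"
    using card_ident_classes by (intro card_ge_0_finite) simp
  have "inj_on (act_class R1) ?S"
    using group_action.inj_prop[OF group_action_DSR in_carrier_G]
    by (rule inj_on_subset) (use symmetric_configs_subset_DS in \<open>auto simp: DSR_ident_class\<close>)
  then have "card (act_class R1 ` ?S) = card ?S"
    by (rule card_image)
  then show "card DSR = 88345080"
    using DSR_decomposition fin card_Un_disjoint[of ?S "act_class R1 ` ?S"] card_ident_classes by simp
  then show "finite DSR"
    by (intro card_ge_0_finite) simp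
qed

theorem proposition3:
  shows "card (orbits G DSR act_class) = 11043660"
proof -
  interpret group_action G DSR act_class
    by (rule group_action_DSR)
  have carrier: "carrier G = {R0, R1, R2, R3, K0, K1, K2, K3}"
    by (simp add: G_def UNIV_sym)
  have "inj_on ident_class (rotation_configs 3)"
    using inj_on_ident_class by (rule inj_on_subset) (simp add: representatives_def)
  then have K1: "card (invariants DSR act_class K1) = 2100"
    by (simp add: invariants_K1 card_image card_rotation_configs)
  have "act_class R0 C = C" if "C \<in> DSR" for C
    using id_eq_one that by (metis G_def monoid.select_convs(2) restrict_apply')
  then have R0: "invariants DSR act_class R0 = DSR"
    by (auto simp: invariants_def)
  have "card (orbits G DSR act_class) * order G = (\<Sum>T\<in>carrier G. card (invariants DSR act_class T))"
    by (rule burnside) (simp_all add: finite_DSR)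
  also have "order G = 8"
    by (simp add: order_def carrier)
  \<comment> \<open>Only the identity and the two diagonal reflections have fixed classes.\<close>
  also have "(\<Sum>T\<in>carrier G. card (invariants DSR act_class T)) = 88345080 + 2100 + 2100"
    unfolding carrier by (simp add: invariants_eq_empty R0 card_DSR K1 card_invariants_K3)
  finally show ?thesis
    by simp
qed

end
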